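(* Let $n$ be a positive integer. Then $r(T_{n-3}',T_n'')=r(T_{n-3}',T_n''')=2n-9$ for $n\ge 10$, and $r(T_{n-3}',T_n^3)=2n-9$ for $n\ge 15$.
   Context: All graphs are finite simple graphs. For graphs $G_1,G_2$, the Ramsey number $r(G_1,G_2)$ is the smallest positive integer $N$ such that for every graph $G$ on $N$ vertices, either $G$ contains a (not necessarily induced) subgraph isomorphic to $G_1$, or the complement $\overline{G}$ contains a subgraph isomorphic to $G_2$. $T_k'$ is the unique tree on $k$ vertices with maximum degree $k-2$. On vertex set $\{v_0,\ldots,v_{n-1}\}$: $T_n''$ has edges $v_0v_1,\ldots,v_0v_{n-4},v_1v_{n-3},v_1v_{n-2},v_2v_{n-1}$; $T_n'''$ has edges $v_0v_1,\ldots,v_0v_{n-4},v_1v_{n-3},v_2v_{n-2},v_3v_{n-1}$; $T_n^3$ has edges $v_0v_1,\ldots,v_0v_{n-4},v_{n-4}v_{n-3},v_{n-4}v_{n-2},v_{n-4}v_{n-1}$. *)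

theory Defs
  imports "Graph_Theory.Graph_Theory"
begin

text \<open>
  A finite simple graph is a symmetric loop-free digraph with finitely many vertices, i.e.
  \<^term>\<open>pair_graph G\<close>; every edge uv is represented by the two arcs (u,v) and (v,u).
\<close>

definition graph_of_edges :: "'a set \<Rightarrow> ('a \<times> 'a) set \<Rightarrow> 'a pair_pre_digraph" where
  "graph_of_edges V E = \<lparr>pverts = V, parcs = E \<union> E\<inverse>\<rparr>"

definition complement :: "'a pair_pre_digraph \<Rightarrow> 'a pair_pre_digraph" where
  "complement G = \<lparr>pverts = pverts G,
     parcs = {(u, v). u \<in> pverts G \<and> v \<in> pverts G \<and> u \<noteq> v \<and> (u, v) \<notin> parcs G}\<rparr>"

definition contains_copy :: "'a pair_pre_digraph \<Rightarrow> 'b pair_pre_digraph \<Rightarrow> bool" where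
  "contains_copy G F \<longleftrightarrow>
     (\<exists>H :: 'a pair_pre_digraph. pair_graph H \<and> subgraph (with_proj H) (with_proj G) \<and>
        digraph_iso (with_proj F) (with_proj H))"

definition ramsey_number :: "'a pair_pre_digraph \<Rightarrow> 'b pair_pre_digraph \<Rightarrow> nat" where
  "ramsey_number F1 F2 = (LEAST N. 0 < N \<and>
     (\<forall>G :: nat pair_pre_digraph. pair_graph G \<and> card (pverts G) = N \<longrightarrow>
        contains_copy G F1 \<or> contains_copy (complement G) F2))"

text \<open>
  The library's \<^const>\<open>tree\<close> is a notion for directed graphs: it regards the closed walk
  u, v, u along an edge as a cycle and hence excludes every symmetric graph with an edge.
  The cycles of an undirected graph are the cycles of length at least 3.
\<close>

definition undirected_tree :: "'a pair_pre_digraph \<Rightarrow> bool" where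
  "undirected_tree G \<longleftrightarrow> pair_graph G \<and> connected (with_proj G) \<and>
     \<not> (\<exists>p. pre_digraph.cycle (with_proj G) p \<and> 3 \<le> length p)"

definition max_degree :: "'a pair_pre_digraph \<Rightarrow> nat" where
  "max_degree G = Max (out_degree (with_proj G) ` pverts G)"

text \<open>
  For k at least 4 there is exactly one such tree up to isomorphism; existence is shown in
  \<open>is_T'_exists\<close> below.
\<close>

definition is_T' :: "nat \<Rightarrow> 'a pair_pre_digraph \<Rightarrow> bool" where
  "is_T' k T \<longleftrightarrow> undirected_tree T \<and> card (pverts T) = k \<and> max_degree T = k - 2"

definition T'' :: "nat \<Rightarrow> nat pair_pre_digraph" where
  "T'' n = graph_of_edges {0..<n}
     ({(0, i) | i. 1 \<le> i \<and> i \<le> n - 4} \<union> {(1, n - 3), (1, n - 2), (2, n - 1)})"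

definition T''' :: "nat \<Rightarrow> nat pair_pre_digraph" where
  "T''' n = graph_of_edges {0..<n}
     ({(0, i) | i. 1 \<le> i \<and> i \<le> n - 4} \<union> {(1, n - 3), (2, n - 2), (3, n - 1)})"

definition T3 :: "nat \<Rightarrow> nat pair_pre_digraph" where
  "T3 n = graph_of_edges {0..<n}
     ({(0, i) | i. 1 \<le> i \<and> i \<le> n - 4} \<union> {(n - 4, n - 3), (n - 4, n - 2), (n - 4, n - 1)})"

lemma pair_graph_iff:
  "pair_graph G \<longleftrightarrow> finite (pverts G) \<and> parcs G \<subseteq> pverts G \<times> pverts G \<and> sym (parcs G) \<and>
     (\<forall>u. (u, u) \<notin> parcs G)"
proof
  assume "pair_graph G"
  then interpret pair_graph G .
  show "finite (pverts G) \<and> parcs G \<subseteq> pverts G \<times> pverts G \<and> sym (parcs G) \<and> (\<forall>u. (u, u) \<notin> parcs G)"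
    using pair_finite_verts in_arcsD1 in_arcsD2 arcs_symmetric no_loops' by (fastforce intro: symI)
next
  assume r: "finite (pverts G) \<and> parcs G \<subseteq> pverts G \<times> pverts G \<and> sym (parcs G) \<and> (\<forall>u. (u, u) \<notin> parcs G)"
  then have "finite (parcs G)" by (meson finite_SigmaI finite_subset)
  with r show "pair_graph G"
    by unfold_locales (auto simp: symmetric_def)
qed

lemma pair_graph_graph_of_edges:
  assumes "finite V" "E \<subseteq> V \<times> V" "\<And>u. (u, u) \<notin> E"
  shows "pair_graph (graph_of_edges V E)"
  using assms by (auto simp: pair_graph_iff graph_of_edges_def sym_def)

lemma pair_graph_T'': "n \<ge> 6 \<Longrightarrow> pair_graph (T'' n)"
  unfolding T''_def by (rule pair_graph_graph_of_edges) auto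

lemma pair_graph_T''': "n \<ge> 7 \<Longrightarrow> pair_graph (T''' n)"
  unfolding T'''_def by (rule pair_graph_graph_of_edges) auto

lemma pair_graph_T3: "n \<ge> 5 \<Longrightarrow> pair_graph (T3 n)"
  unfolding T3_def by (rule pair_graph_graph_of_edges) auto

lemma pair_graph_complement: "pair_graph G \<Longrightarrow> pair_graph (complement G)"
  by (auto simp: pair_graph_iff complement_def sym_def)

lemma pair_graph_wf_digraph: "pair_graph G \<Longrightarrow> wf_digraph (with_proj G)"
  by (simp add: wf_digraph_wp_iff pair_graph_def pair_digraph_def pair_fin_digraph_def)

lemma contains_copy_iff:
  assumes "pair_graph G" "pair_graph F"
  shows "contains_copy G F \<longleftrightarrow>
    (\<exists>f. inj_on f (pverts F) \<and> f ` pverts F \<subseteq> pverts G \<and>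
       (\<forall>u v. (u, v) \<in> parcs F \<longrightarrow> (f u, f v) \<in> parcs G))"
    (is "_ \<longleftrightarrow> (\<exists>f. ?emb f)")
proof
  assume "contains_copy G F"
  then obtain H h where H: "subgraph (with_proj H) (with_proj G)"
    and h: "pre_digraph.digraph_isomorphism (with_proj F) h"
    and eq: "with_proj H = app_iso h (with_proj F)"
    unfolding contains_copy_def digraph_iso_def by blast
  have t: "iso_tail h = fst" "iso_head h = snd"
    using arg_cong[OF eq, of tail] arg_cong[OF eq, of head] by simp_all
  have v: "pverts H = iso_verts h ` pverts F" and a: "parcs H = iso_arcs h ` parcs F"
    using arg_cong[OF eq, of verts] arg_cong[OF eq, of arcs] by simp_all
  have m: "iso_arcs h (u, w) = (iso_verts h u, iso_verts h w)" if "(u, w) \<in> parcs F" for u w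
    using h that t by (auto simp: pre_digraph.digraph_isomorphism_def prod_eq_iff)
  have "?emb (iso_verts h)"
  proof (intro conjI allI impI)
    show "inj_on (iso_verts h) (pverts F)"
      using h by (simp add: pre_digraph.digraph_isomorphism_def)
    show "iso_verts h ` pverts F \<subseteq> pverts G"
      using H v by (simp add: subgraph_def)
    fix u w assume uw: "(u, w) \<in> parcs F"
    then have "iso_arcs h (u, w) \<in> parcs H" unfolding a by (rule imageI)
    then show "(iso_verts h u, iso_verts h w) \<in> parcs G"
      using H m[OF uw] by (auto simp: subgraph_def)
  qed
  then show "\<exists>f. ?emb f" by (intro exI[of _ "iso_verts h"])
next
  assume "\<exists>f. ?emb f"
  then obtain f where f: "?emb f" ..
  define H where "H = \<lparr>pverts = f ` pverts F, parcs = map_prod f f ` parcs F\<rparr>"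
  define h where "h = \<lparr>iso_verts = f, iso_arcs = map_prod f f, iso_head = snd, iso_tail = fst\<rparr>"
  have F: "parcs F \<subseteq> pverts F \<times> pverts F" "sym (parcs F)" "\<And>u. (u, u) \<notin> parcs F" "finite (pverts F)"
    using assms(2) by (auto simp: pair_graph_iff)
  have H: "pair_graph H"
    unfolding pair_graph_iff
  proof (intro conjI allI)
    show "sym (parcs H)" using F(2) by (force simp: H_def sym_def)
    show "(u, u) \<notin> parcs H" for u
    proof
      assume "(u, u) \<in> parcs H"
      then obtain x y where xy: "(x, y) \<in> parcs F" "f x = f y" by (auto simp: H_def)
      then have "x = y" using f F(1) by (auto dest: inj_onD)
      then show False using xy F(3) by simp
    qed
  qed (use F in \<open>auto simp: H_def\<close>)
  have "subgraph (with_proj H) (with_proj G)"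
    using f pair_graph_wf_digraph[OF H] pair_graph_wf_digraph[OF assms(1)] by (auto simp: subgraph_def compatible_def H_def)
  moreover have "inj_on (map_prod f f) (parcs F)"
  proof (rule inj_onI)
    fix d e assume "d \<in> parcs F" "e \<in> parcs F" "map_prod f f d = map_prod f f e"
    then show "d = e" using f F(1) by (cases d; cases e) (auto dest: inj_onD)
  qed
  then have "pre_digraph.digraph_isomorphism (with_proj F) h"
    using f pair_graph_wf_digraph[OF assms(2)] by (auto simp: pre_digraph.digraph_isomorphism_def h_def)
  moreover have "with_proj H = app_iso h (with_proj F)"
    by (simp add: with_proj_def app_iso_def h_def H_def)
  ultimately show "contains_copy G F"
    using H unfolding contains_copy_def digraph_iso_def by blast
qed

lemma pcas_nth:
  "pcas u p v \<Longrightarrow> Suc i < length p \<Longrightarrow> fst (p ! Suc i) = snd (p ! i)"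
proof (induction p arbitrary: u i)
  case (Cons e p)
  then show ?case by (cases i; cases p) auto
qed simp

lemma pcas_ends:
  "pcas u p v \<Longrightarrow> p \<noteq> [] \<Longrightarrow> fst (p ! 0) = u \<and> snd (p ! (length p - 1)) = v"
proof (induction p arbitrary: u)
  case (Cons e p)
  then show ?case by (cases p) auto
qed simp

lemma tl_pawalk_verts: "pcas u p v \<Longrightarrow> tl (pawalk_verts u p) = map snd p"
proof (induction p arbitrary: u)
  case (Cons e p)
  then show ?case by (cases p) auto
qed simp

lemma cycle_leaf:
  assumes cyc: "pre_digraph.cycle (with_proj G) p" "3 \<le> length p" and G: "pair_graph G"
    and leaf: "\<And>x. (v, x) \<in> parcs G \<Longrightarrow> x = u"
  shows "v \<notin> set (map snd p)"
proof
  let ?L = "length p"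
  from cyc(1) obtain w where w: "pcas w p w" "p \<noteq> []" "distinct (tl (pawalk_verts w p))"
    and sub: "set p \<subseteq> parcs G"
    by (auto simp: pre_digraph.cycle_def pre_digraph.awalk_def cas_with_proj_eq
        awalk_verts_with_proj_eq)
  have d: "distinct (map snd p)" using w(3) tl_pawalk_verts[OF w(1)] by simp
  define nxt where "nxt i = (if Suc i < ?L then Suc i else 0)" for i
  have nxt: "fst (p ! nxt i) = snd (p ! i)" if "i < ?L" for i
  proof (cases "Suc i < ?L")
    case True
    then show ?thesis using pcas_nth[OF w(1)] by (simp add: nxt_def)
  next
    case False
    then have "i = ?L - 1" using that by simp
    then show ?thesis using False pcas_ends[OF w(1,2)] by (simp add: nxt_def)
  qed
  assume "v \<in> set (map snd p)"
  then obtain i where i: "i < ?L" "snd (p ! i) = v"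
    by (auto simp: in_set_conv_nth)
  define k where "k = (if i = 0 then ?L - 1 else i - 1)"
  have L: "nxt i < ?L" "k < ?L" "nxt k = i" "nxt i \<noteq> k"
    using i cyc(2) by (auto simp: nxt_def k_def)
  have "p ! i \<in> parcs G" "p ! nxt i \<in> parcs G"
    using sub i L nth_mem by blast+
  moreover have "fst (p ! nxt i) = v" using nxt[OF i(1)] i(2) by simp
  ultimately have "(v, fst (p ! i)) \<in> parcs G" "(v, snd (p ! nxt i)) \<in> parcs G"
    using G i(2) by (auto simp: pair_graph_iff dest!: symD)
  then have "fst (p ! i) = u" "snd (p ! nxt i) = u" using leaf by blast+
  moreover have "snd (p ! k) = fst (p ! i)" using nxt[OF L(2)] L(3) by simp
  ultimately have "map snd p ! k = map snd p ! nxt i" using L by simp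
  then show False using d L by (simp add: nth_eq_iff_index_eq del: nth_map)
qed

lemma is_T'_exists:
  assumes "4 \<le> k"
  shows "\<exists>T :: nat pair_pre_digraph. is_T' k T"
proof
  define T where
    "T = graph_of_edges {0..<k} ({(0 :: nat, i) | i. 1 \<le> i \<and> i \<le> k - 2} \<union> {(1, k - 1)})"
  have T: "pair_graph T" unfolding T_def by (rule pair_graph_graph_of_edges) (use assms in auto)
  then interpret pair_graph T .
  have arcs: "(x, y) \<in> parcs T \<longleftrightarrow> x = 0 \<and> 1 \<le> y \<and> y \<le> k - 2 \<or> y = 0 \<and> 1 \<le> x \<and> x \<le> k - 2
      \<or> x = 1 \<and> y = k - 1 \<or> y = 1 \<and> x = k - 1" for x y
    by (auto simp: T_def graph_of_edges_def)
  have V: "pverts T = {0..<k}" by (simp add: T_def graph_of_edges_def)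
  have r0: "x \<rightarrow>\<^sup>*\<^bsub>with_proj T\<^esub> 0" if "x \<in> pverts T" for x
  proof (cases "x = 0 \<or> x \<le> k - 2")
    case True
    then have "x = 0 \<or> (x, 0) \<in> parcs T" by (auto simp: arcs)
    then show ?thesis using that by (auto intro: reachable_refl reachable_adjI)
  next
    case False
    then have "(x, 1) \<in> parcs T" "(1, 0) \<in> parcs T"
      using that assms by (auto simp: V arcs)
    then show ?thesis by (meson reachable_adjI reachable_trans with_proj_simps)
  qed
  have sc: "strongly_connected (with_proj T)"
    unfolding strongly_connected_def
  proof (intro conjI ballI)
    show "verts (with_proj T) \<noteq> {}" using assms by (simp add: V)
  next
    fix x y assume "x \<in> verts (with_proj T)" "y \<in> verts (with_proj T)"
    then show "x \<rightarrow>\<^sup>*\<^bsub>with_proj T\<^esub> y"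
      using r0 symmetric_reachable[OF sym_arcs] reachable_trans by (metis with_proj_simps(1))
  qed
  have conn: "connected (with_proj T)"
  proof -
    have "mk_symmetric (with_proj T) = T"
      using arcs_symmetric by (intro pair_pre_digraph.equality) (auto simp: mk_symmetric_def)
    then show ?thesis using sc by (simp add: connected_def)
  qed
  have "False" if p: "pre_digraph.cycle (with_proj T) p" "3 \<le> length p" for p
  proof -
    from p(1) obtain w where w: "pcas w p w" "distinct (tl (pawalk_verts w p))"
      and sub: "set p \<subseteq> parcs T"
      by (auto simp: pre_digraph.cycle_def pre_digraph.awalk_def cas_with_proj_eq
          awalk_verts_with_proj_eq)
    have d: "distinct (map snd p)" using w(2) tl_pawalk_verts[OF w(1)] by simp
    have "v \<in> {0, 1}" if v: "v \<in> set (map snd p)" for v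
    proof (rule ccontr)
      assume n: "v \<notin> {0, 1}"
      have "\<exists>u. \<forall>x. (v, x) \<in> parcs T \<longrightarrow> x = u"
        using n assms by (cases "v = k - 1") (auto simp: arcs)
      then show False using cycle_leaf[OF p T, of v] v by blast
    qed
    then have "set (map snd p) \<subseteq> {0, 1}" by blast
    then have "card (set (map snd p)) \<le> card {0, 1 :: nat}" by (intro card_mono) simp_all
    then show False using distinct_card[OF d] p(2) by simp
  qed
  then have tree: "undirected_tree T" using T conn by (auto simp: undirected_tree_def)
  have deg: "out_degree (with_proj T) v = card {x. (v, x) \<in> parcs T}" for v
  proof -
    have "out_arcs (with_proj T) v = Pair v ` {x. (v, x) \<in> parcs T}"
      by (auto simp: out_arcs_def)
    then show ?thesis by (simp add: out_degree_def card_image inj_on_def)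
  qed
  have "{x. (0, x) \<in> parcs T} = {1..k - 2}" using assms by (auto simp: arcs)
  then have d0: "out_degree (with_proj T) 0 = k - 2" by (simp add: deg)
  have "out_degree (with_proj T) v \<le> k - 2" if "v \<in> pverts T" for v
  proof (cases "v = 0")
    case False
    then have "\<exists>a b. {x. (v, x) \<in> parcs T} \<subseteq> {a, b}"
    proof (cases "v = k - 1")
      case True
      then have "{x. (v, x) \<in> parcs T} \<subseteq> {1, 1}" using assms by (auto simp: arcs)
      then show ?thesis by blast
    next
      case False
      then have "{x. (v, x) \<in> parcs T} \<subseteq> {0, k - 1}" using \<open>v \<noteq> 0\<close> by (auto simp: arcs)
      then show ?thesis by blast
    qed
    then obtain a b where "{x. (v, x) \<in> parcs T} \<subseteq> {a, b}" by blast
    then have "out_degree (with_proj T) v \<le> card {a, b}"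
      unfolding deg by (intro card_mono) simp_all
    also have "\<dots> \<le> 2" by (cases "a = b") simp_all
    finally show ?thesis using assms by linarith
  qed (simp add: d0)
  then have "max_degree T = k - 2"
    unfolding max_degree_def
    by (intro Max_eqI) (use d0 assms in \<open>auto simp: V intro!: image_eqI[of _ _ 0]\<close>)
  then show "is_T' k T" using tree by (simp add: is_T'_def V)
qed

end

theory Submission
  imports Defs
begin

text \<open>
  Write \<open>k = n - 5\<close>. Two disjoint copies of \<open>K\<^sub>k\<close> have maximum degree \<open>k - 1\<close> and their complement
  has maximum degree \<open>k\<close>, which is too small for both trees and gives the lower bound.
  For the upper bound let \<open>G\<close> have \<open>2k + 1\<close> vertices and not contain \<open>T'\<close>. If \<open>G\<close> has a vertex of
  degree at least \<open>k\<close>, then its component is a large star or has exactly \<open>k + 1\<close> vertices, so the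
  complement contains \<open>K\<^bsub>4,n-4\<^esub>\<close> and hence all three trees. Otherwise the complement has minimum
  degree at least \<open>n - 4\<close>; fix any vertex \<open>z\<close> and split the others into \<open>S\<close>, consisting
  essentially of the non-neighbours of \<open>z\<close>, and \<open>M\<close>, consisting of neighbours of \<open>z\<close>. Every vertex
  of \<open>S\<close> has at least three neighbours in \<open>M\<close>, and double counting yields a vertex of \<open>M\<close> with two
  (for \<open>n \<ge> 15\<close>, three) neighbours in \<open>S\<close>, from which the trees with centre \<open>z\<close> are built.
\<close>

section \<open>Neighbourhoods, degrees and injections\<close>

definition nb :: "'a pair_pre_digraph \<Rightarrow> 'a \<Rightarrow> 'a set" where
  "nb G v = {u. (v, u) \<in> parcs G}"

lemma in_nb [simp]: "u \<in> nb G v \<longleftrightarrow> (v, u) \<in> parcs G"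
  by (simp add: nb_def)

lemma pair_graph_sym: "pair_graph G \<Longrightarrow> (u, v) \<in> parcs G \<longleftrightarrow> (v, u) \<in> parcs G"
  by (auto simp: pair_graph_iff dest: symD)

lemma pair_graph_irrefl: "pair_graph G \<Longrightarrow> (u, u) \<notin> parcs G"
  by (simp add: pair_graph_iff)

lemma pair_graph_finite: "pair_graph G \<Longrightarrow> finite (pverts G)"
  by (simp add: pair_graph_iff)

lemma nb_subset: "pair_graph G \<Longrightarrow> nb G v \<subseteq> pverts G - {v}"
  by (auto simp: pair_graph_iff)

lemma finite_nb: "pair_graph G \<Longrightarrow> finite (nb G v)"
  using nb_subset pair_graph_finite by (meson finite_Diff finite_subset)

lemma nb_complement: "v \<in> pverts G \<Longrightarrow> nb (complement G) v = pverts G - {v} - nb G v"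
  by (auto simp: complement_def)

lemma pverts_complement [simp]: "pverts (complement G) = pverts G"
  by (simp add: complement_def)

lemma out_degree_eq_card_nb: "out_degree (with_proj G) v = card (nb G v)"
proof -
  have "out_arcs (with_proj G) v = Pair v ` nb G v"
    by (auto simp: out_arcs_def)
  then show ?thesis by (simp add: out_degree_def card_image inj_on_def)
qed

text \<open>An embedding maps the neighbours of \<open>c\<close> injectively to neighbours of its
  image. This is the degree obstruction behind the lower bound.\<close>

lemma contains_copy_degree:
  assumes "pair_graph G" "pair_graph F" "contains_copy G F" "c \<in> pverts F"
  shows "\<exists>v \<in> pverts G. card (nb F c) \<le> card (nb G v)"
proof -
  obtain f where f: "inj_on f (pverts F)" "f ` pverts F \<subseteq> pverts G"
    "\<And>u v. (u, v) \<in> parcs F \<Longrightarrow> (f u, f v) \<in> parcs G"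
    using assms contains_copy_iff by metis
  have "card (nb F c) = card (f ` nb F c)"
    using f(1) nb_subset[OF assms(2)] by (metis card_image inj_on_subset Diff_subset subset_trans)
  also have "\<dots> \<le> card (nb G (f c))"
    using f(3) by (intro card_mono finite_nb assms) auto
  finally show ?thesis using f(2) assms(4) by blast
qed

lemma inj_on_Un_separated:
  assumes "inj_on f A" "inj_on f B" "f ` A \<subseteq> C" "f ` B \<inter> C = {}"
  shows "inj_on f (A \<union> B)"
  unfolding inj_on_Un using assms by blast

text \<open>Used for stars: the few leaves in \<open>P\<close> that carry further edges get
  prescribed images, and the other leaves go anywhere in what is left of \<open>M\<close>.\<close>

lemma extend_injection:
  assumes "finite A" "finite M" "card A \<le> card M" "P \<subseteq> A" "inj_on h P" "h ` P \<subseteq> M"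
  shows "\<exists>g. inj_on g A \<and> g ` A \<subseteq> M \<and> (\<forall>x\<in>P. g x = h x)"
proof -
  have P: "finite P" using assms finite_subset by blast
  have "card (A - P) \<le> card (M - h ` P)"
    using assms P by (simp add: card_Diff_subset card_image)
  then obtain k where k: "inj_on k (A - P)" "k ` (A - P) \<subseteq> M - h ` P"
    using assms card_le_inj[of "A - P" "M - h ` P"] by auto
  let ?g = "\<lambda>x. if x \<in> P then h x else k x"
  have "inj_on ?g P" "inj_on ?g (A - P)"
    using assms(5) k(1) by (simp_all add: inj_on_def)
  moreover have "?g ` P \<subseteq> h ` P" "?g ` (A - P) \<inter> h ` P = {}" using k(2) by auto
  ultimately have "inj_on ?g (P \<union> (A - P))" by (rule inj_on_Un_separated)
  then have "inj_on ?g A" using assms(4) by (simp add: Un_absorb1)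
  moreover have "?g ` A \<subseteq> M" using k(2) assms(6) by auto
  ultimately show ?thesis by (intro exI[of _ ?g]) simp
qed

section \<open>The tree of order k and maximum degree k - 2\<close>

text \<open>Take \<open>c\<close> of maximum degree: its closed neighbourhood misses exactly one
  vertex \<open>x\<close>. Connectivity joins \<open>x\<close> to some neighbour \<open>a\<close> of
  \<open>c\<close>, and any further edge would close a triangle through \<open>c\<close> or a
  4-cycle through \<open>c\<close> and \<open>x\<close>.\<close>

lemma is_T'_structure:
  assumes "is_T' k T" "4 \<le> k"
  obtains c x a where "pverts T = insert c (insert x (nb T c))" "card (nb T c) = k - 2"
    "x \<noteq> c" "x \<notin> nb T c" "a \<in> nb T c"
    "\<forall>u v. (u, v) \<in> parcs T \<longrightarrow>
       u = c \<and> v \<in> nb T c \<or> v = c \<and> u \<in> nb T c \<or> u = a \<and> v = x \<or> u = x \<and> v = a"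
proof -
  have T: "pair_graph T" and conn: "connected (with_proj T)"
    and acyc: "\<And>p. pre_digraph.cycle (with_proj T) p \<Longrightarrow> \<not> 3 \<le> length p"
    and card: "card (pverts T) = k" and md: "max_degree T = k - 2"
    using assms by (auto simp: is_T'_def undirected_tree_def)
  interpret pair_graph T by (rule T)
  have fin: "finite (pverts T)" and ne: "pverts T \<noteq> {}"
    using card assms(2) T by (auto simp: pair_graph_finite)
  have "max_degree T \<in> out_degree (with_proj T) ` pverts T"
    unfolding max_degree_def using fin ne by (intro Max_in) auto
  then obtain c where c: "c \<in> pverts T" "card (nb T c) = k - 2"
    using md by (auto simp: out_degree_eq_card_nb)
  have cs: "nb T c \<subseteq> pverts T - {c}" by (rule nb_subset[OF T])
  have "card (pverts T - {c} - nb T c) = 1"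
    using c cs card assms(2) fin finite_subset[OF cs] by (simp add: card_Diff_subset)
  then obtain x where x: "pverts T - {c} - nb T c = {x}" by (auto simp: card_1_singleton_iff)
  have V: "pverts T = insert c (insert x (nb T c))" using x cs c by auto
  have xc: "x \<noteq> c" "x \<notin> nb T c" "x \<in> pverts T" using equalityD2[OF x] by blast+
  \<comment> \<open>\<open>connected\<close> means strong connectivity of the symmetric closure, and
    \<open>T\<close> is already symmetric. The first arc of a path from \<open>x\<close> to
    \<open>c\<close> then provides \<open>a\<close>.\<close>
  have "mk_symmetric (with_proj T) = T"
    using arcs_symmetric by (intro pair_pre_digraph.equality) (auto simp: mk_symmetric_def)
  then have "strongly_connected (with_proj T)" using conn by (simp add: connected_def)
  then have "x \<rightarrow>\<^sup>*\<^bsub>with_proj T\<^esub> c"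
    using xc c by (auto simp: strongly_connected_def)
  then obtain a where a: "(x, a) \<in> parcs T"
    using xc(1) by (cases rule: converse_reachable_cases) auto
  have anc: "a \<in> nb T c"
  proof -
    have "a \<in> pverts T - {x}" using nb_subset[OF T, of x] a by auto
    moreover have "a \<noteq> c" using a xc(2) pair_graph_sym[OF T] by auto
    ultimately show ?thesis using V by auto
  qed
  have tri: False if "(u, v) \<in> parcs T" "u \<in> nb T c" "v \<in> nb T c" for u v
  proof -
    have "u \<noteq> v" "u \<noteq> c" "v \<noteq> c" using that pair_graph_irrefl[OF T] by auto
    then have "pre_digraph.cycle (with_proj T) [(c, u), (u, v), (v, c)]"
      using that c(1) pair_graph_sym[OF T]
      by (auto simp: pre_digraph.cycle_def pre_digraph.awalk_def cas_with_proj_eq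
          awalk_verts_with_proj_eq intro!: exI[of _ c])
    then show False using acyc by fastforce
  qed
  have quad: False if "(x, v) \<in> parcs T" "v \<in> nb T c" "v \<noteq> a" for v
  proof -
    have "a \<noteq> x" "v \<noteq> x" "a \<noteq> c" "v \<noteq> c" using that a anc pair_graph_irrefl[OF T] by auto
    then have "pre_digraph.cycle (with_proj T) [(c, a), (a, x), (x, v), (v, c)]"
      using that a anc xc c(1) pair_graph_sym[OF T]
      by (auto simp: pre_digraph.cycle_def pre_digraph.awalk_def cas_with_proj_eq
          awalk_verts_with_proj_eq intro!: exI[of _ c])
    then show False using acyc by fastforce
  qed
  show thesis
  proof (rule that[OF V c(2) xc(1,2) anc], intro allI impI)
    fix u v assume uv: "(u, v) \<in> parcs T"
    then have m: "u \<in> pverts T" "v \<in> pverts T" "u \<noteq> v" "(v, u) \<in> parcs T"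
      using T pair_graph_sym[OF T] by (auto simp: pair_graph_iff)
    show "u = c \<and> v \<in> nb T c \<or> v = c \<and> u \<in> nb T c \<or> u = a \<and> v = x \<or> u = x \<and> v = a"
      using uv m V tri[OF uv] quad[of v] quad[of u] by auto
  qed
qed

text \<open>The tree is a star with one pendant edge added at a leaf: \<open>v\<close> is the
  centre, \<open>A\<close> the leaves, and \<open>b\<close> hangs on \<open>a\<close>. The vertex
  \<open>b\<close> may be another neighbour of \<open>v\<close>.\<close>

lemma contains_T':
  assumes T: "is_T' k T" "4 \<le> k" and G: "pair_graph G"
    and A: "A \<subseteq> nb G v" "card A = k - 2" "a \<in> A" "b \<notin> A" "b \<noteq> v" "(a, b) \<in> parcs G"
  shows "contains_copy G T"
proof -
  have pT: "pair_graph T" using T by (simp add: is_T'_def undirected_tree_def)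
  obtain c x a' where s: "pverts T = insert c (insert x (nb T c))" "card (nb T c) = k - 2"
    "x \<noteq> c" "x \<notin> nb T c" "a' \<in> nb T c"
    and arcs: "\<forall>u v. (u, v) \<in> parcs T \<longrightarrow>
       u = c \<and> v \<in> nb T c \<or> v = c \<and> u \<in> nb T c \<or> u = a' \<and> v = x \<or> u = x \<and> v = a'"
    by (rule is_T'_structure[OF T]) (rule that)
  have "\<exists>g. inj_on g (nb T c) \<and> g ` nb T c \<subseteq> A \<and> (\<forall>y\<in>{a'}. g y = (\<lambda>_. a) y)"
    using s A finite_subset[OF A(1) finite_nb[OF G]]
    by (intro extend_injection finite_nb pT) auto
  then obtain g where g: "inj_on g (nb T c)" "g ` nb T c \<subseteq> A" "g a' = a" by auto
  define f where "f = g(c := v, x := b)"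
  have c: "c \<notin> nb T c" using nb_subset[OF pT] by blast
  have vA: "v \<notin> A" using A(1) nb_subset[OF G, of v] by blast
  have fc: "f c = v" "f x = b" and fg: "\<And>y. y \<in> nb T c \<Longrightarrow> f y = g y"
    using s(3,4) c by (auto simp: f_def)
  have gA: "g y \<in> A" if "y \<in> nb T c" for y using g(2) that by blast
  have V: "pverts T = nb T c \<union> {c, x}" using s(1) by blast
  have "inj_on f (nb T c)" by (rule iffD2[OF inj_on_cong g(1)]) (rule fg)
  moreover have "inj_on f {c, x}" using A(5) fc unfolding inj_on_def by auto
  moreover have "f ` nb T c \<subseteq> A" using fg gA by (simp add: image_subset_iff del: in_nb)
  moreover have "f ` {c, x} \<inter> A = {}" using fc vA A(4) by simp
  ultimately have "inj_on f (pverts T)" unfolding V by (rule inj_on_Un_separated)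
  moreover have "f ` pverts T \<subseteq> pverts G"
  proof -
    have "A \<subseteq> pverts G" "a \<in> nb G v" using A nb_subset[OF G, of v] by auto
    moreover have "v \<in> pverts G" "b \<in> pverts G"
      using A G \<open>a \<in> nb G v\<close> by (auto simp: pair_graph_iff)
    ultimately show ?thesis using fc \<open>f ` nb T c \<subseteq> A\<close> unfolding V by auto
  qed
  moreover have "(f u, f w) \<in> parcs G" if "(u, w) \<in> parcs T" for u w
  proof -
    have nbg: "(v, g y) \<in> parcs G" "(g y, v) \<in> parcs G" if "y \<in> nb T c" for y
      using gA[OF that] A(1) pair_graph_sym[OF G] by auto
    show ?thesis using arcs[rule_format, OF that]
    proof (elim disjE conjE)
      assume "u = c" "w \<in> nb T c" then show ?thesis using nbg fc fg by metis
    next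
      assume "w = c" "u \<in> nb T c" then show ?thesis using nbg fc fg by metis
    next
      assume "u = a'" "w = x" then show ?thesis using A(6) fc fg s(5) g(3) by metis
    next
      assume "u = x" "w = a'"
      then show ?thesis using A(6) fc fg s(5) g(3) pair_graph_sym[OF G] by metis
    qed
  qed
  ultimately show ?thesis unfolding contains_copy_iff[OF G pT] by blast
qed

section \<open>Brooms: stars with three pendant edges attached to leaves\<close>

text \<open>A common form of the three trees: centre 0, leaves 1 to n - 4, and one further vertex
  hung on each of \<open>p\<close>, \<open>q\<close>, \<open>r\<close>, which may coincide.\<close>

definition broom :: "nat \<Rightarrow> nat \<Rightarrow> nat \<Rightarrow> nat \<Rightarrow> nat pair_pre_digraph" where
  "broom n p q r = graph_of_edges {0..<n}
     ({(0, i) | i. 1 \<le> i \<and> i \<le> n - 4} \<union> {(p, n - 3), (q, n - 2), (r, n - 1)})"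

lemma T''_broom: "T'' n = broom n 1 1 2"
  by (simp add: T''_def broom_def)

lemma T'''_broom: "T''' n = broom n 1 2 3"
  by (simp add: T'''_def broom_def)

lemma T3_broom: "T3 n = broom n (n - 4) (n - 4) (n - 4)"
  by (simp add: T3_def broom_def)

lemma pair_graph_broom:
  assumes "{p, q, r} \<subseteq> {1..n - 4}"
  shows "pair_graph (broom n p q r)"
  unfolding broom_def using assms by (intro pair_graph_graph_of_edges) auto

lemma card_nb_broom:
  assumes "{p, q, r} \<subseteq> {1..n - 4}"
  shows "n - 4 \<le> card (nb (broom n p q r) 0)"
proof -
  have "{1..n - 4} \<subseteq> nb (broom n p q r) 0"
    by (auto simp: broom_def graph_of_edges_def)
  from card_mono[OF finite_nb[OF pair_graph_broom[OF assms]] this] show ?thesis by simp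
qed

text \<open>Only the images of \<open>p\<close>, \<open>q\<close>, \<open>r\<close> have to be
  chosen by hand. As the end vertices \<open>w1\<close>, \<open>w2\<close>, \<open>w3\<close> avoid
  \<open>M\<close> and \<open>z\<close>, the other leaves fill up \<open>M\<close> freely.\<close>

lemma contains_broom:
  assumes H: "pair_graph H" and pqr: "{p, q, r} \<subseteq> {1..n - 4}"
    and h: "inj_on h {p, q, r}" "h ` {p, q, r} \<subseteq> M"
    and M: "n - 4 \<le> card M" "M \<subseteq> nb H z" "z \<in> pverts H"
    and w: "distinct [w1, w2, w3]" "{w1, w2, w3} \<inter> insert z M = {}"
    and e: "(h p, w1) \<in> parcs H" "(h q, w2) \<in> parcs H" "(h r, w3) \<in> parcs H"
  shows "contains_copy H (broom n p q r)"
proof -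
  have n: "5 \<le> n" using pqr by auto
  have "finite M" using M(2) finite_nb[OF H] finite_subset by blast
  then have "\<exists>g. inj_on g {1..n - 4} \<and> g ` {1..n - 4} \<subseteq> M \<and> (\<forall>x\<in>{p, q, r}. g x = h x)"
    using M pqr h by (intro extend_injection) auto
  then obtain g where g: "inj_on g {1..n - 4}" "g ` {1..n - 4} \<subseteq> M"
    "g p = h p" "g q = h q" "g r = h r"
    by auto
  define f where "f i = (if i = 0 then z else if i = n - 3 then w1 else if i = n - 2 then w2
    else if i = n - 1 then w3 else g i)" for i
  have f0: "f 0 = z" and fw: "f (n - 3) = w1" "f (n - 2) = w2" "f (n - 1) = w3"
    using n by (auto simp: f_def)
  have fg: "f i = g i" if "i \<in> {1..n - 4}" for i using that n by (auto simp: f_def)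
  have gM: "g i \<in> M" if "i \<in> {1..n - 4}" for i using g(2) that by blast
  have V: "{0..<n} = {1..n - 4} \<union> {0, n - 3, n - 2, n - 1}" using n by auto
  have zM: "z \<notin> M" using M(2) nb_subset[OF H] by blast
  have "inj_on f {1..n - 4}" by (rule iffD2[OF inj_on_cong g(1)]) (rule fg)
  moreover have "inj_on f {0, n - 3, n - 2, n - 1}"
    using w f0 fw by (auto simp: inj_on_def simp del: One_nat_def)
  moreover have "f ` {1..n - 4} \<subseteq> M" using fg gM by auto
  moreover have "f ` {0, n - 3, n - 2, n - 1} \<inter> M = {}"
    using w(2) zM unfolding image_insert f0 fw by simp
  ultimately have "inj_on f {0..<n}" unfolding V by (rule inj_on_Un_separated)
  moreover have "f ` {0..<n} \<subseteq> pverts H"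
  proof -
    have "M \<subseteq> pverts H" using M nb_subset[OF H] by blast
    moreover have "{w1, w2, w3} \<subseteq> pverts H" using e H by (auto simp: pair_graph_iff)
    ultimately show ?thesis unfolding V using \<open>f ` {1..n - 4} \<subseteq> M\<close> M(3) f0 fw by auto
  qed
  moreover have "(f u, f v) \<in> parcs H" if "(u, v) \<in> parcs (broom n p q r)" for u v
  proof -
    have star: "(f 0, f i) \<in> parcs H" if "i \<in> {1..n - 4}" for i
      using gM[OF that] fg[OF that] f0 M(2) by auto
    have "f p = h p" "f q = h q" "f r = h r" using fg g pqr by auto
    then have pend: "(f p, f (n - 3)) \<in> parcs H" "(f q, f (n - 2)) \<in> parcs H"
      "(f r, f (n - 1)) \<in> parcs H"
      using e fw by auto
    have "(u, v) \<in> {(0, i) | i. i \<in> {1..n - 4}} \<union> {(p, n - 3), (q, n - 2), (r, n - 1)} \<or>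
      (v, u) \<in> {(0, i) | i. i \<in> {1..n - 4}} \<union> {(p, n - 3), (q, n - 2), (r, n - 1)}"
      using that by (auto simp: broom_def graph_of_edges_def)
    then show ?thesis using star pend pair_graph_sym[OF H] by blast
  qed
  moreover have "pverts (broom n p q r) = {0..<n}"
    by (simp add: broom_def graph_of_edges_def)
  ultimately show ?thesis
    unfolding contains_copy_iff[OF H pair_graph_broom[OF pqr]] by auto
qed

lemma obtain_distinct3:
  assumes "3 \<le> card X"
  obtains x y z where "{x, y, z} \<subseteq> X" "distinct [x, y, z]"
proof -
  obtain Y where Y: "Y \<subseteq> X" "card Y = 3" using obtain_subset_with_card_n[OF assms] by blast
  then obtain x y z where "Y = {x, y, z}" "distinct [x, y, z]" by (auto simp: card_3_iff)
  then show thesis using that Y(1) by blast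
qed

text \<open>One vertex of \<open>X\<close> serves as the centre and three others as the ends. Each
  leaf in \<open>M\<close> is adjacent to all four, so the positions of \<open>p\<close>,
  \<open>q\<close>, \<open>r\<close> do not matter.\<close>

lemma contains_broom_bipartite:
  assumes H: "pair_graph H" and pqr: "{p, q, r} \<subseteq> {1..n - 4}"
    and M: "n - 4 \<le> card M" and X: "4 \<le> card X" "X \<inter> M = {}"
    and e: "\<And>m x. m \<in> M \<Longrightarrow> x \<in> X \<Longrightarrow> (m, x) \<in> parcs H"
  shows "contains_copy H (broom n p q r)"
proof -
  obtain z where z: "z \<in> X" using X(1) by fastforce
  have "3 \<le> card (X - {z})" using X(1) z by (simp add: card_Diff_singleton)
  then obtain w1 w2 w3 where w: "{w1, w2, w3} \<subseteq> X - {z}" "distinct [w1, w2, w3]"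
    using obtain_distinct3 by blast
  have Mz: "M \<subseteq> nb H z" using e[OF _ z] pair_graph_sym[OF H] by auto
  then have "finite M" using finite_nb[OF H] finite_subset by blast
  then obtain h where h: "inj_on h {1..n - 4}" "h ` {1..n - 4} \<subseteq> M"
    using card_le_inj[of "{1..n - 4}" M] M by auto
  have hM: "h ` {p, q, r} \<subseteq> M" using h(2) pqr by blast
  have "h p \<in> M" using hM by simp
  then have "(z, h p) \<in> parcs H" using Mz by auto
  then have "z \<in> pverts H" using H by (auto simp: pair_graph_iff)
  with hM Mz M w X e show ?thesis
    by (intro contains_broom[OF H pqr inj_on_subset[OF h(1) pqr] hM, where z = z]) auto
qed

section \<open>Graphs of minimum degree at least n - 4\<close>

lemma double_count:
  assumes "finite S" "finite M" "\<And>s. s \<in> S \<Longrightarrow> c \<le> card {m \<in> M. R s m}"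
    and "d * card M < c * card S"
  shows "\<exists>m\<in>M. d < card {s \<in> S. R s m}"
proof (rule ccontr)
  assume "\<not> ?thesis"
  then have le: "card {s \<in> S. R s m} \<le> d" if "m \<in> M" for m using that by force
  have "c * card S = (\<Sum>s\<in>S. c)" by simp
  also have "\<dots> \<le> (\<Sum>s\<in>S. card {m \<in> M. R s m})" using assms(3) by (intro sum_mono)
  also have "\<dots> = (\<Sum>m\<in>M. card {s \<in> S. R s m})"
    using sum_multicount_gen[OF assms(1,2), of R "\<lambda>m. card {s \<in> S. R s m}"] by simp
  also have "\<dots> \<le> (\<Sum>m\<in>M. d)" using le by (intro sum_mono)
  also have "\<dots> = d * card M" by simp
  finally show False using assms(4) by simp
qed

text \<open>\<open>z\<close> will be the centre, \<open>M\<close> the reservoir of leaves and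
  \<open>S\<close> that of ends. The value d = 1 yields a leaf with two ends, d = 2 a leaf with
  three.\<close>

lemma dense_split:
  assumes H: "pair_graph H" and card: "card (pverts H) = 2 * n - 9"
    and deg: "\<And>v. v \<in> pverts H \<Longrightarrow> n - 4 \<le> card (nb H v)"
    and d: "d = 1 \<and> 10 \<le> n \<or> d = 2 \<and> 15 \<le> n"
  obtains z S M where "z \<in> pverts H" "M \<subseteq> nb H z" "n - 4 \<le> card M" "S \<inter> insert z M = {}"
    "3 \<le> card S" "\<And>s. s \<in> S \<Longrightarrow> 3 \<le> card (nb H s \<inter> M)" "\<exists>m\<in>M. d < card (nb H m \<inter> S)"
proof -
  note goal = that
  let ?V = "pverts H"
  have fV: "finite ?V" by (rule pair_graph_finite[OF H])
  have "?V \<noteq> {}" using card d by auto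
  then obtain z where z: "z \<in> ?V" by blast
  define W where "W = ?V - {z} - nb H z"
  have Wn: "card W \<le> n - 6"
    using card deg[OF z] z fV nb_subset[OF H, of z] d
    by (auto simp: W_def card_Diff_subset finite_nb[OF H])
  have cVz: "card (?V - {z}) = 2 * n - 10" using z card by (simp add: card_Diff_singleton)
  have fin: "finite S" if "S \<subseteq> ?V" for S using that fV finite_subset by blast
  \<comment> \<open>Reduces the goal to a choice of \<open>S\<close>: containing the non-neighbours
    \<open>W\<close> forces the rest into \<open>nb H z\<close>, size at most n - 6 leaves n - 4
    leaves, and \<open>lt\<close> is the double-counting inequality.\<close>
  have main: thesis
    if S: "W \<subseteq> S" "S \<subseteq> ?V - {z}" "3 \<le> card S" "card S \<le> n - 6" "3 \<le> c"
      and c: "\<And>s. s \<in> S \<Longrightarrow> c \<le> card (nb H s \<inter> (?V - {z} - S))"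
      and lt: "d * (2 * n - 10 - card S) < c * card S" for S c
  proof -
    let ?M = "?V - {z} - S"
    have fS: "finite S" using S(2) fin by blast
    have cM: "card ?M = 2 * n - 10 - card S" using cVz S(2) fS by (simp add: card_Diff_subset)
    have "{m \<in> ?M. m \<in> nb H s} = nb H s \<inter> ?M" for s by auto
    then have "\<exists>m\<in>?M. d < card {s \<in> S. m \<in> nb H s}"
      using c lt fS fV cM by (intro double_count) auto
    moreover have "{s \<in> S. m \<in> nb H s} = nb H m \<inter> S" for m
      using pair_graph_sym[OF H] by auto
    ultimately have ex: "\<exists>m\<in>?M. d < card (nb H m \<inter> S)" by simp
    have Mz: "?M \<subseteq> nb H z" using S(1) by (auto simp: W_def)
    have Mn: "n - 4 \<le> card ?M" using cM S(4) d by auto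
    have disj: "S \<inter> insert z ?M = {}" using S(2) by auto
    have "3 \<le> card (nb H s \<inter> ?M)" if "s \<in> S" for s
      using c[OF that] S(5) by simp
    then show thesis by (rule goal[OF z Mz Mn disj S(3) _ ex])
  qed
  have bound: "n - 4 \<le> card (nb H s \<inter> (?V - {z} - S)) + card (nb H s \<inter> (insert z S - {s}))"
    if "s \<in> ?V" for s S
  proof -
    have "nb H s \<subseteq> (nb H s \<inter> (?V - {z} - S)) \<union> (nb H s \<inter> (insert z S - {s}))"
      using nb_subset[OF H, of s] by auto
    then have "card (nb H s) \<le> card ((nb H s \<inter> (?V - {z} - S)) \<union> (nb H s \<inter> (insert z S - {s})))"
      by (intro card_mono finite_UnI finite_Int disjI1 finite_nb[OF H])
    then show ?thesis using deg[OF that] card_Un_le le_trans by blast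
  qed
  show thesis
  proof (cases "2 * d + 1 \<le> card W")
    case True
    have W6: "card W + 6 \<le> n" using Wn d by auto
    \<comment> \<open>With S = W, no \<open>s\<close> is adjacent to \<open>z\<close>, so at least n
      - 4 - (card W - 1) = 3 + t neighbours lie in \<open>M\<close>. The threshold 2d + 1 is the
      size required of \<open>S\<close> when d = 1, and what the count requires at t = 0 when d =
      2.\<close>
    obtain t where t: "n = card W + 6 + t" using W6 le_Suc_ex by blast
    obtain j where j: "card W = 2 * d + 1 + j" using True le_Suc_ex by blast
    show ?thesis
    proof (rule main[of W "3 + t"])
      fix s assume s: "s \<in> W"
      then have "nb H s \<inter> (insert z W - {s}) \<subseteq> W - {s}"
        using pair_graph_sym[OF H] by (auto simp: W_def)
      then have "card (nb H s \<inter> (insert z W - {s})) \<le> card W - 1"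
        using s fV card_mono[of "W - {s}" "nb H s \<inter> (insert z W - {s})"]
        by (simp add: W_def card_Diff_singleton)
      then show "3 + t \<le> card (nb H s \<inter> (?V - {z} - W))"
        using bound[of s W] s t j by (auto simp: W_def)
    next
      show "d * (2 * n - 10 - card W) < (3 + t) * card W"
        using d by (elim disjE) (simp_all add: t j algebra_simps)
    qed (use Wn True d in \<open>auto simp: W_def\<close>)
  next
    case False
    \<comment> \<open>Here \<open>z\<close> is adjacent to almost all vertices. With \<open>card S = 3 * d\<close> the double count
      just suffices for \<open>n = 15\<close> when \<open>d = 2\<close>; with 4 or 5 vertices it would not.\<close>
    have "3 * d \<le> card (?V - {z})" "card W \<le> 3 * d" using cVz d False by auto
    then obtain S where S: "W \<subseteq> S" "S \<subseteq> ?V - {z}" "card S = 3 * d"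
      using exists_subset_between[of W "3 * d" "?V - {z}"] fV by (auto simp: W_def)
    have fS: "finite S" using S(2) fin by blast
    show ?thesis
    proof (rule main[of S "n - 4 - 3 * d"])
      fix s assume s: "s \<in> S"
      then have "s \<noteq> z" using S by auto
      \<comment> \<open>Here \<open>s\<close> may be adjacent to \<open>z\<close>, so one neighbour
        more can be lost than for S = W.\<close>
      have "card (nb H s \<inter> (insert z S - {s})) \<le> card (insert z S - {s})"
        using fS by (intro card_mono) auto
      also have "\<dots> = 3 * d" using S s fS \<open>s \<noteq> z\<close> by (auto simp: card_insert_if)
      finally show "n - 4 - 3 * d \<le> card (nb H s \<inter> (?V - {z} - S))"
        using bound[of s S] s S by auto
    next
      obtain m where "n = 10 + m \<and> d = 1 \<or> n = 15 + m \<and> d = 2"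
        using d le_Suc_ex by blast
      then show "d * (2 * n - 10 - card S) < (n - 4 - 3 * d) * card S"
        using S(3) by auto
    qed (use S d in auto)
  qed
qed

lemma obtain_notin:
  assumes "card B < card X" "finite B"
  obtains x where "x \<in> X" "x \<notin> B"
  using assms by (metis card_mono leD subsetI)

text \<open>\<open>T''\<close> needs a leaf with two ends in \<open>S\<close> and another leaf with
  one, \<open>T'''\<close> a matching of size three between \<open>M\<close> and \<open>S\<close>,
  and \<open>T3\<close> a leaf with three ends. The last needs d = 2, hence the bound 15.\<close>

lemma dense_contains:
  assumes H: "pair_graph H" and card: "card (pverts H) = 2 * n - 9"
    and deg: "\<And>v. v \<in> pverts H \<Longrightarrow> n - 4 \<le> card (nb H v)"
  shows "10 \<le> n \<Longrightarrow> contains_copy H (T'' n)"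
    and "10 \<le> n \<Longrightarrow> contains_copy H (T''' n)"
    and "15 \<le> n \<Longrightarrow> contains_copy H (T3 n)"
proof -
  assume n: "10 \<le> n"
  obtain z S M where s: "z \<in> pverts H" "M \<subseteq> nb H z" "n - 4 \<le> card M" "S \<inter> insert z M = {}"
    "3 \<le> card S" and S3: "\<And>s. s \<in> S \<Longrightarrow> 3 \<le> card (nb H s \<inter> M)"
    and ex: "\<exists>m\<in>M. 1 < card (nb H m \<inter> S)"
    using n by (rule_tac dense_split[OF H card deg, of 1]) auto
  \<comment> \<open>Greedy choice of leaves: \<open>B\<close> holds the at most two leaves already
    taken, while \<open>w\<close> has three neighbours in \<open>M\<close>.\<close>
  have pick: "\<exists>m\<in>M. (m, w) \<in> parcs H \<and> m \<notin> B" if w: "w \<in> S" and B: "finite B" "card B < 3" for w B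
  proof -
    have "card B < card (nb H w \<inter> M)" using S3[OF w] B(2) by simp
    then obtain m where "m \<in> nb H w \<inter> M" "m \<notin> B" using obtain_notin B(1) by metis
    then show ?thesis using pair_graph_sym[OF H] by auto
  qed
  show "contains_copy H (T'' n)"
  proof -
    obtain a where a: "a \<in> M" "2 \<le> card (nb H a \<inter> S)" using ex by auto
    then obtain Y where "Y \<subseteq> nb H a \<inter> S" "card Y = 2" using obtain_subset_with_card_n by metis
    then obtain w1 w2 where w: "w1 \<noteq> w2" "{w1, w2} \<subseteq> nb H a \<inter> S" by (auto simp: card_2_iff)
    have "card {w1, w2} < card S" using s(5) w by simp
    then obtain w3 where w3: "w3 \<in> S" "w3 \<notin> {w1, w2}" using obtain_notin by blast
    obtain b where b: "b \<in> M" "(b, w3) \<in> parcs H" "b \<noteq> a" using pick[OF w3(1), of "{a}"] by auto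
    define h where "h i = (if i = 1 then a else b)" for i :: nat
    show ?thesis unfolding T''_broom
      by (rule contains_broom[OF H, where h = h and z = z and M = M
            and ?w1.0 = w1 and ?w2.0 = w2 and ?w3.0 = w3])
        (use n s w w3 a b in \<open>auto simp: h_def\<close>)
  qed
  show "contains_copy H (T''' n)"
  proof -
    obtain w1 w2 w3 where w: "{w1, w2, w3} \<subseteq> S" "distinct [w1, w2, w3]"
      using obtain_distinct3[OF s(5)] by blast
    obtain a where a: "a \<in> M" "(a, w1) \<in> parcs H" using pick[of w1 "{}"] w by auto
    obtain b where b: "b \<in> M" "(b, w2) \<in> parcs H" "b \<noteq> a" using pick[of w2 "{a}"] w by auto
    obtain c where c: "c \<in> M" "(c, w3) \<in> parcs H" "c \<notin> {a, b}"
      using pick[of w3 "{a, b}"] w b(3) by auto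
    define h where "h i = (if i = 1 then a else if i = 2 then b else c)" for i :: nat
    show ?thesis unfolding T'''_broom
      by (rule contains_broom[OF H, where h = h and z = z and M = M
            and ?w1.0 = w1 and ?w2.0 = w2 and ?w3.0 = w3])
        (use n s w a b c in \<open>auto simp: h_def\<close>)
  qed
next
  assume n: "15 \<le> n"
  obtain z S M where s: "z \<in> pverts H" "M \<subseteq> nb H z" "n - 4 \<le> card M" "S \<inter> insert z M = {}"
    and ex: "\<exists>m\<in>M. 2 < card (nb H m \<inter> S)"
    using n by (rule_tac dense_split[OF H card deg, of 2]) auto
  obtain a where a: "a \<in> M" "3 \<le> card (nb H a \<inter> S)" using ex by auto
  obtain w1 w2 w3 where w: "{w1, w2, w3} \<subseteq> nb H a \<inter> S" "distinct [w1, w2, w3]"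
    using obtain_distinct3[OF a(2)] by blast
  \<comment> \<open>All three ends hang on the single leaf n - 4, so a constant \<open>h\<close> is
    injective on the set of attachment points.\<close>
  show "contains_copy H (T3 n)" unfolding T3_broom
    by (rule contains_broom[OF H, where h = "\<lambda>_. a" and z = z and M = M
          and ?w1.0 = w1 and ?w2.0 = w2 and ?w3.0 = w3])
      (use n s w a in auto)
qed

section \<open>A vertex of degree at least n - 5\<close>

text \<open>The centre of \<open>T\<close> has degree n - 5. If \<open>v\<close> has exactly this
  degree, no edge leaves its closed neighbourhood; if it has more, no edge joins n - 4 chosen
  neighbours to the vertices other than these and \<open>v\<close>. Either way the complement has a
  complete bipartite subgraph with sides of size n - 4 and at least n - 6, which is at least
  4.\<close>

lemma complement_contains_broom:
  assumes T: "is_T' (n - 3) T" and n: "10 \<le> n"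
    and G: "pair_graph G" and card: "card (pverts G) = 2 * n - 9"
    and noT: "\<not> contains_copy G T" and pqr: "{p, q, r} \<subseteq> {1..n - 4}"
    and v: "v \<in> pverts G" "n - 5 \<le> card (nb G v)"
  shows "contains_copy (complement G) (broom n p q r)"
proof -
  let ?V = "pverts G"
  have fV: "finite ?V" by (rule pair_graph_finite[OF G])
  have n3: "4 \<le> n - 3" using n by simp
  have no: False if "A \<subseteq> nb G v" "card A = n - 5" "a \<in> A" "b \<notin> A" "b \<noteq> v" "(a, b) \<in> parcs G"
    for A a b
    using contains_T'[OF T n3 G, of A v a b] that noT by simp
  have bip: ?thesis if "M \<subseteq> ?V" "X \<subseteq> ?V" "X \<inter> M = {}" "card M = n - 4" "4 \<le> card X"
    "\<And>m x. m \<in> M \<Longrightarrow> x \<in> X \<Longrightarrow> (m, x) \<notin> parcs G" for M X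
    by (rule contains_broom_bipartite[OF pair_graph_complement[OF G] pqr, of M X])
      (use that in \<open>auto simp: complement_def\<close>)
  show ?thesis
  proof (cases "card (nb G v) = n - 5")
    case True
    let ?M = "insert v (nb G v)"
    have sub: "?M \<subseteq> ?V" using v nb_subset[OF G] by blast
    have cM: "card ?M = n - 4"
      using True finite_nb[OF G, of v] nb_subset[OF G, of v] n by (subst card_insert_disjoint) auto
    have cX: "card (?V - ?M) = n - 5"
      using sub cM card fV finite_subset[OF sub] n by (subst card_Diff_subset) auto
    have noe: "(m, x) \<notin> parcs G" if "m \<in> ?M" "x \<in> ?V - ?M" for m x
      using no[of "nb G v" m x] that True by auto
    show ?thesis
      by (rule bip[where X = "?V - ?M", OF sub _ _ cM _ noe]) (use cX n in auto)
  next
    case False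
    then have "n - 4 \<le> card (nb G v)" using v by simp
    then obtain M where M: "M \<subseteq> nb G v" "card M = n - 4"
      using obtain_subset_with_card_n by metis
    let ?X = "?V - insert v M"
    have sub: "insert v M \<subseteq> ?V" "v \<notin> M" using M(1) v nb_subset[OF G] by blast+
    have "finite M" using sub fV finite_subset by auto
    then have "card (insert v M) = n - 3" using M sub n by simp
    then have cX: "card ?X = n - 6"
      using sub(1) card fV finite_subset[OF sub(1)] n by (subst card_Diff_subset) auto
    have noe: "(m, x) \<notin> parcs G" if "m \<in> M" "x \<in> ?X" for m x
    proof
      assume e: "(m, x) \<in> parcs G"
      have fd: "finite (nb G v - {x})" using finite_nb[OF G] by auto
      \<comment> \<open>\<open>x\<close> may itself be a neighbour of \<open>v\<close>; the leaves
        must avoid it, and enough remain after its removal.\<close>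
      have "n - 5 \<le> card (nb G v - {x})"
        using \<open>n - 4 \<le> card (nb G v)\<close> card_Diff1_le[of "nb G v" x]
        by (cases "x \<in> nb G v") (simp_all add: card_Diff_singleton)
      moreover have "{m} \<subseteq> nb G v - {x}" using that M(1) by auto
      moreover have "card {m} \<le> n - 5" using n by simp
      ultimately obtain A where "{m} \<subseteq> A" "A \<subseteq> nb G v - {x}" "card A = n - 5"
        using exists_subset_between[of "{m}" "n - 5" "nb G v - {x}"] fd by metis
      then show False using no[of A m x] e that by auto
    qed
    show ?thesis
      by (rule bip[where X = ?X, OF _ _ _ M(2) _ noe]) (use sub cX n in auto)
  qed
qed

section \<open>Lower bound and the Ramsey number\<close>

text \<open>The first \<open>k\<close> vertices and the remaining ones form two disjoint cliques. As
  \<open>ramsey_number\<close> is a least element, every N up to 2k must be refuted, so the cliques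
  may have fewer than \<open>k\<close> vertices.\<close>

lemma ramsey_lower_graph:
  assumes "N \<le> 2 * k"
  obtains G :: "nat pair_pre_digraph" where "pair_graph G" "card (pverts G) = N"
    "\<And>v. v \<in> pverts G \<Longrightarrow> card (nb G v) < k"
    "\<And>v. v \<in> pverts G \<Longrightarrow> card (nb (complement G) v) \<le> k"
proof -
  define G :: "nat pair_pre_digraph" where
    "G = \<lparr>pverts = {0..<N}, parcs = {(u, v). u < N \<and> v < N \<and> u \<noteq> v \<and> (u < k \<longleftrightarrow> v < k)}\<rparr>"
  \<comment> \<open>\<open>D v\<close> is the block of \<open>v\<close>, filled up to exactly
    \<open>k\<close> numbers even if N is below 2k.\<close>
  define D where "D v = (if v < k then {0..<k} else {k..<2 * k})" for v
  have D: "finite (D v)" "card (D v) = k" for v by (auto simp: D_def)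
  have 1: "pair_graph G" by (auto simp: pair_graph_iff G_def sym_def)
  have 2: "card (pverts G) = N" by (simp add: G_def)
  have 3: "card (nb G v) < k" if "v \<in> pverts G" for v
  proof -
    have "nb G v \<subseteq> D v - {v}" "v \<in> D v" using that assms by (auto simp: G_def D_def)
    then have "nb G v \<subset> D v" by auto
    then show ?thesis using D psubset_card_mono by metis
  qed
  have 4: "card (nb (complement G) v) \<le> k" if "v \<in> pverts G" for v
  proof -
    define E where "E = (if v < k then {k..<2 * k} else {0..<k})"
    have "nb (complement G) v \<subseteq> E"
      using that assms by (auto simp: E_def complement_def G_def)
    then have "card (nb (complement G) v) \<le> card E" by (intro card_mono) (auto simp: E_def)
    then show ?thesis by (simp add: E_def split: if_splits)
  qed
  show thesis by (rule that[OF 1 2 3 4])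
qed

text \<open>Splits on whether \<open>G\<close> has a vertex of degree at least n - 5. Only the other
  case depends on the positions of \<open>p\<close>, \<open>q\<close>, \<open>r\<close>, so it
  enters as the hypothesis \<open>dense\<close>.\<close>

lemma ramsey_number_broom:
  fixes T :: "'a pair_pre_digraph"
  assumes T: "is_T' (n - 3) T" and n: "10 \<le> n" and pqr: "{p, q, r} \<subseteq> {1..n - 4}"
    and dense: "\<And>H :: nat pair_pre_digraph. pair_graph H \<Longrightarrow> card (pverts H) = 2 * n - 9 \<Longrightarrow>
      (\<And>v. v \<in> pverts H \<Longrightarrow> n - 4 \<le> card (nb H v)) \<Longrightarrow> contains_copy H (broom n p q r)"
  shows "ramsey_number T (broom n p q r) = 2 * n - 9"
  unfolding ramsey_number_def
proof (rule Least_equality, intro conjI allI impI)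
  show "0 < 2 * n - 9" using n by simp
  fix G :: "nat pair_pre_digraph"
  assume "pair_graph G \<and> card (pverts G) = 2 * n - 9"
  then have G: "pair_graph G" "card (pverts G) = 2 * n - 9" by auto
  have "contains_copy (complement G) (broom n p q r)" if noT: "\<not> contains_copy G T"
  proof (cases "\<exists>v\<in>pverts G. n - 5 \<le> card (nb G v)")
    case True
    then show ?thesis using complement_contains_broom[OF T n G noT pqr] by blast
  next
    case False
    \<comment> \<open>Degrees in \<open>G\<close> are at most n - 6, and the two degrees of
      \<open>v\<close> add up to 2n - 10.\<close>
    have "n - 4 \<le> card (nb (complement G) v)" if v: "v \<in> pverts G" for v
    proof -
      have "card (nb (complement G) v) = card (pverts G - {v}) - card (nb G v)"
        unfolding nb_complement[OF v]
        using nb_subset[OF G(1)] finite_nb[OF G(1)] by (intro card_Diff_subset)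
      then show ?thesis using False v G(2) by (auto simp: card_Diff_singleton not_le)
    qed
    then show ?thesis using G by (intro dense) (auto intro: pair_graph_complement)
  qed
  then show "contains_copy G T \<or> contains_copy (complement G) (broom n p q r)" by blast
next
  fix N
  assume N: "0 < N \<and> (\<forall>G :: nat pair_pre_digraph. pair_graph G \<and> card (pverts G) = N \<longrightarrow>
    contains_copy G T \<or> contains_copy (complement G) (broom n p q r))"
  show "2 * n - 9 \<le> N"
  proof (rule ccontr)
    assume "\<not> 2 * n - 9 \<le> N"
    then have "N \<le> 2 * (n - 5)" using n by simp
    from ramsey_lower_graph[OF this] obtain G :: "nat pair_pre_digraph"
      where G: "pair_graph G" "card (pverts G) = N"
        "\<And>v. v \<in> pverts G \<Longrightarrow> card (nb G v) < n - 5"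
        "\<And>v. v \<in> pverts G \<Longrightarrow> card (nb (complement G) v) \<le> n - 5"
      by blast
    have "\<not> contains_copy G T"
    proof
      assume copy: "contains_copy G T"
      have pT: "pair_graph T" using T by (simp add: is_T'_def undirected_tree_def)
      have "4 \<le> n - 3" using n by simp
      then obtain c where "c \<in> pverts T" "card (nb T c) = n - 3 - 2"
        by (rule is_T'_structure[OF T]) (rule that, simp_all)
      then show False using contains_copy_degree[OF G(1) pT copy] G(3) by fastforce
    qed
    moreover have "\<not> contains_copy (complement G) (broom n p q r)"
    proof
      assume copy: "contains_copy (complement G) (broom n p q r)"
      have "0 \<in> pverts (broom n p q r)" using n by (simp add: broom_def graph_of_edges_def)
      from contains_copy_degree[OF pair_graph_complement[OF G(1)] pair_graph_broom[OF pqr] copy this]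
      show False using G(4) card_nb_broom[OF pqr] n by fastforce
    qed
    ultimately show False using N G by blast
  qed
qed

theorem theorem5p3:
  fixes n :: nat and T' :: "'a pair_pre_digraph"
  assumes "0 < n"
    and "is_T' (n - 3) T'"
  shows "(10 \<le> n \<longrightarrow> ramsey_number T' (T'' n) = 2 * n - 9 \<and>
                    ramsey_number T' (T''' n) = 2 * n - 9) \<and>
         (15 \<le> n \<longrightarrow> ramsey_number T' (T3 n) = 2 * n - 9)"
proof (intro conjI impI)
  assume n: "10 \<le> n"
  show "ramsey_number T' (T'' n) = 2 * n - 9" unfolding T''_broom
    by (rule ramsey_number_broom[OF assms(2) n])
      (use n dense_contains(1)[of _ n] in \<open>auto simp: T''_broom\<close>)
  show "ramsey_number T' (T''' n) = 2 * n - 9" unfolding T'''_broom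
    by (rule ramsey_number_broom[OF assms(2) n])
      (use n dense_contains(2)[of _ n] in \<open>auto simp: T'''_broom\<close>)
next
  assume n: "15 \<le> n"
  then have "10 \<le> n" by simp
  then show "ramsey_number T' (T3 n) = 2 * n - 9" unfolding T3_broom
    by (rule ramsey_number_broom[OF assms(2)])
      (use n dense_contains(3)[of _ n] in \<open>auto simp: T3_broom\<close>)
qed

end
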